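(* Let $A, B \in \mathbb{P}$. Then: (1) The map $X \mapsto A \#_{t} X$ is a bijection on $\mathbb{P}$ for any $t \in (0,1]$. (2) The map $X \mapsto X \#_{t} B$ is a bijection on $\mathbb{P}$ for any $t \in [0,1)$.
   Context: $\mathcal{H}$ is a Hilbert space, $B(\mathcal{H})$ is the space of bounded linear operators on $\mathcal{H}$, and $\mathbb{P} \subset B(\mathcal{H})$ is the open convex cone of positive definite (that is, self-adjoint, positive and invertible) operators. For $A, B \in \mathbb{P}$ and $t \in [0,1]$, the weighted geometric mean is $A \#_{t} B := A^{1/2} (A^{-1/2} B A^{-1/2})^{t} A^{1/2}$, where real powers of positive definite operators are taken by functional calculus. *)

theory Defs
  imports "HOL-Analysis.Analysis" "HOL-Computational_Algebra.Polynomial"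
begin

text \<open>
  Real Hilbert spaces are the types of sort \<open>{real_inner, complete_space}\<close>. A complex Hilbert space
  is given together with its underlying real Hilbert space, whose inner product is the real part of
  the complex one; so \<open>cinner x x\<close> is the real number \<open>(norm x)\<^sup>2\<close>, and norm, topology and
  operator norm are those of the complex space. The complex inner product is linear in its first
  argument.
\<close>

class complex_hilbert = real_inner + complete_space +
  fixes scaleC :: "complex \<Rightarrow> 'a \<Rightarrow> 'a" (infixr "*\<^sub>C" 75)
    and cinner :: "'a \<Rightarrow> 'a \<Rightarrow> complex"
  assumes scaleC_add_right: "c *\<^sub>C (x + y) = c *\<^sub>C x + c *\<^sub>C y"
    and scaleC_add_left: "(c + d) *\<^sub>C x = c *\<^sub>C x + d *\<^sub>C x"
    and scaleC_scaleC: "c *\<^sub>C (d *\<^sub>C x) = (c * d) *\<^sub>C x"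
    and scaleC_one: "1 *\<^sub>C x = x"
    and scaleR_scaleC: "r *\<^sub>R x = complex_of_real r *\<^sub>C x"
    and cinner_commute: "cinner x y = cnj (cinner y x)"
    and cinner_add_left: "cinner (x + y) z = cinner x z + cinner y z"
    and cinner_scaleC_left: "cinner (c *\<^sub>C x) y = c * cinner x y"
    and inner_eq_Re_cinner: "inner x y = Re (cinner x y)"

text \<open>If the invertible operator is complex-linear, then so is its inverse.\<close>

definition invertible_op :: "('a::real_normed_vector \<Rightarrow>\<^sub>L 'a) \<Rightarrow> bool" where
  "invertible_op T \<longleftrightarrow> (\<exists>S. S o\<^sub>L T = id_blinfun \<and> T o\<^sub>L S = id_blinfun)"

definition posdef :: "('h::{real_inner, complete_space} \<Rightarrow>\<^sub>L 'h) set" where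
  "posdef = {T. (\<forall>x y. inner (blinfun_apply T x) y = inner x (blinfun_apply T y)) \<and>
                (\<forall>x. 0 \<le> inner (blinfun_apply T x) x) \<and>
                invertible_op T}"

definition cposdef :: "('h::complex_hilbert \<Rightarrow>\<^sub>L 'h) set" where
  "cposdef = {T. (\<forall>c x. blinfun_apply T (c *\<^sub>C x) = c *\<^sub>C blinfun_apply T x) \<and>
                 (\<forall>x y. cinner (blinfun_apply T x) y = cinner x (blinfun_apply T y)) \<and>
                 (\<forall>x. cinner (blinfun_apply T x) x \<in> \<real>\<^sub>\<ge>\<^sub>0) \<and>
                 invertible_op T}"

text \<open>
  The functional calculus below is only meant for self-adjoint operators. Over the complex scalars
  their spectrum consists of real numbers, so real scalars and real polynomials
  suffice.
\<close>

definition op_spectrum :: "('a::real_normed_vector \<Rightarrow>\<^sub>L 'a) \<Rightarrow> real set" where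
  "op_spectrum T = {r. \<not> invertible_op (T - r *\<^sub>R id_blinfun)}"

definition poly_op :: "real poly \<Rightarrow> ('a::real_normed_vector \<Rightarrow>\<^sub>L 'a) \<Rightarrow> ('a \<Rightarrow>\<^sub>L 'a)" where
  "poly_op p T = (\<Sum>i\<le>degree p. coeff p i *\<^sub>R (((o\<^sub>L) T ^^ i) id_blinfun))"

text \<open>
  Continuous functional calculus: \<open>f(T)\<close> is the operator-norm limit of \<open>p\<^sub>n(T)\<close> for every sequence of
  polynomials \<open>p\<^sub>n\<close> that converges to \<open>f\<close> uniformly on the spectrum of \<open>T\<close>.
\<close>

definition fun_calc :: "('a::real_normed_vector \<Rightarrow>\<^sub>L 'a) \<Rightarrow> (real \<Rightarrow> real) \<Rightarrow> ('a \<Rightarrow>\<^sub>L 'a)" where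
  "fun_calc T f = (THE F. \<forall>p :: nat \<Rightarrow> real poly.
     uniform_limit (op_spectrum T) (\<lambda>n. poly (p n)) f sequentially \<longrightarrow>
     (\<lambda>n. poly_op (p n) T) \<longlonglongrightarrow> F)"

definition op_powr :: "('a::real_normed_vector \<Rightarrow>\<^sub>L 'a) \<Rightarrow> real \<Rightarrow> ('a \<Rightarrow>\<^sub>L 'a)" where
  "op_powr T t = fun_calc T (\<lambda>x. x powr t)"

definition geom_mean :: "real \<Rightarrow> ('a::real_normed_vector \<Rightarrow>\<^sub>L 'a) \<Rightarrow> ('a \<Rightarrow>\<^sub>L 'a) \<Rightarrow> ('a \<Rightarrow>\<^sub>L 'a)" where
  "geom_mean t A B =
     op_powr A (1/2) o\<^sub>L
     op_powr (op_powr A (-1/2) o\<^sub>L B o\<^sub>L op_powr A (-1/2)) t o\<^sub>L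
     op_powr A (1/2)"

end

(*
  Everything rests on the spectral bound for polynomials p in a self-adjoint operator T,
  norm p(T) <= sup |p| over the spectrum of T. Over the reals it is obtained without
  complexification: the norm or its negative lies in the spectrum of a self-adjoint operator, and a
  real polynomial without zeros on the spectrum of T factors into linear terms invertible at T
  and irreducible quadratics (x - a)^2 + b^2, which are coercive at T. Since the spectrum of a
  positive definite operator lies in a compact interval of positive numbers, the laws of powers
  follow by approximation with polynomials on such intervals.

  With C = A^(-1/2) X A^(-1/2), the equation A #_t X = Y says C^t = A^(-1/2) Y A^(-1/2), so
  Y |-> A #_(1/t) Y inverts X |-> A #_t X. The second map reduces to the first by
  A #_t B = B #_(1-t) A; there B^(-1/2) A B^(-1/2) = V C^(-1) U, where U = A^(1/2) B^(-1/2) and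
  V = U^(-1), and powers commute with similarities. In the complex case all constructions
  stay in the commutant of the multiplications by complex scalars.
*)

theory Submission
  imports Defs "HOL-Computational_Algebra.Fundamental_Theorem_Algebra"
begin

section \<open>Operators on a Hilbert space\<close>

text \<open>The pointwise limits form a bounded operator, and letting \<open>m\<close> tend to
  infinity in \<open>norm (X n - X m) < e / 2\<close> gives convergence in norm. The codomain has
  the sort intersection because a type of sort \<open>{real_inner, complete_space}\<close> need not
  be an instance of \<open>banach\<close>.\<close>

lemma blinfun_Cauchy_convergent:
  fixes X :: "nat \<Rightarrow> 'a::real_normed_vector \<Rightarrow>\<^sub>L 'b::{real_normed_vector, complete_space}"
  assumes "Cauchy X"
  shows "convergent X"
proof -
  define v where "v x = lim (\<lambda>n. blinfun_apply (X n) x)" for x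
  have "Cauchy (\<lambda>n. blinfun_apply (X n) x)" for x
    by (rule bounded_linear.Cauchy[OF blinfun.bounded_linear_left assms])
  then have v: "(\<lambda>n. blinfun_apply (X n) x) \<longlonglongrightarrow> v x" for x
    using Cauchy_convergent convergent_LIMSEQ_iff by (fastforce simp: v_def)
  obtain K where K: "\<And>n. norm (X n) \<le> K"
    using Cauchy_Bseq[OF assms] unfolding Bseq_def by blast
  have "bounded_linear v"
  proof (rule bounded_linear_intro)
    show "v (x + y) = v x + v y" for x y
      using LIMSEQ_unique[OF v[of "x + y"]] tendsto_add[OF v[of x] v[of y]]
      by (simp add: blinfun.add_right)
    show "v (r *\<^sub>R x) = r *\<^sub>R v x" for r x
      using LIMSEQ_unique[OF v[of "r *\<^sub>R x"]] tendsto_scaleR[OF tendsto_const v[of x], of r]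
      by (simp add: blinfun.scaleR_right)
    show "norm (v x) \<le> norm x * K" for x
    proof (rule Lim_bounded[OF tendsto_norm[OF v[of x]]])
      show "\<forall>n\<ge>0. norm (blinfun_apply (X n) x) \<le> norm x * K"
      proof (intro allI impI)
        fix n
        have "norm (blinfun_apply (X n) x) \<le> norm (X n) * norm x"
          by (rule norm_blinfun)
        also have "\<dots> \<le> norm x * K"
          using K[of n] by (metis mult.commute mult_right_mono norm_ge_zero)
        finally show "norm (blinfun_apply (X n) x) \<le> norm x * K" .
      qed
    qed
  qed
  then have V: "blinfun_apply (Blinfun v) = v"
    by (rule bounded_linear_Blinfun_apply)
  have "X \<longlonglongrightarrow> Blinfun v"
  proof (rule LIMSEQ_I)
    fix e :: real
    assume "e > 0"
    then obtain N where N: "\<And>m n. m \<ge> N \<Longrightarrow> n \<ge> N \<Longrightarrow> norm (X m - X n) < e / 2"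
      using CauchyD[OF assms, of "e / 2"] by auto
    have "norm (X n - Blinfun v) \<le> e / 2" if "n \<ge> N" for n
    proof (rule norm_blinfun_bound)
      fix x
      have "(\<lambda>m. norm (blinfun_apply (X n) x - blinfun_apply (X m) x)) \<longlonglongrightarrow>
        norm (blinfun_apply (X n) x - v x)"
        by (intro tendsto_intros v)
      then have "norm (blinfun_apply (X n) x - v x) \<le> e / 2 * norm x"
      proof (rule Lim_bounded)
        show "\<forall>m\<ge>N. norm (blinfun_apply (X n) x - blinfun_apply (X m) x) \<le> e / 2 * norm x"
        proof (intro allI impI)
          fix m assume "m \<ge> N"
          have "norm (blinfun_apply (X n - X m) x) \<le> norm (X n - X m) * norm x"
            by (rule norm_blinfun)
          also have "\<dots> \<le> e / 2 * norm x"
            using N[OF that \<open>m \<ge> N\<close>] by (intro mult_right_mono) auto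
          finally show "norm (blinfun_apply (X n) x - blinfun_apply (X m) x) \<le> e / 2 * norm x"
            by (simp add: blinfun.diff_left)
        qed
      qed
      then show "norm (blinfun_apply (X n - Blinfun v) x) \<le> e / 2 * norm x"
        by (simp add: blinfun.diff_left V)
    qed (use \<open>e > 0\<close> in auto)
    then show "\<exists>N. \<forall>n\<ge>N. norm (X n - Blinfun v) < e"
      using \<open>e > 0\<close> by (intro exI[of _ N]) fastforce
  qed
  then show ?thesis
    by (rule convergentI)
qed

lemma blinfun_compose_assoc: "(A o\<^sub>L B) o\<^sub>L C = A o\<^sub>L (B o\<^sub>L C)"
  by (rule blinfun_eqI) simp

lemma blinfun_compose_id [simp]: "id_blinfun o\<^sub>L A = A" "A o\<^sub>L id_blinfun = A"
  by (rule blinfun_eqI; simp)+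

lemmas blinfun_compose_linear =
  bounded_bilinear.add_left[OF bounded_bilinear_blinfun_compose]
  bounded_bilinear.add_right[OF bounded_bilinear_blinfun_compose]
  bounded_bilinear.diff_left[OF bounded_bilinear_blinfun_compose]
  bounded_bilinear.diff_right[OF bounded_bilinear_blinfun_compose]
  bounded_bilinear.scaleR_left[OF bounded_bilinear_blinfun_compose]
  bounded_bilinear.scaleR_right[OF bounded_bilinear_blinfun_compose]
  bounded_bilinear.sum_left[OF bounded_bilinear_blinfun_compose]
  bounded_bilinear.sum_right[OF bounded_bilinear_blinfun_compose]

section \<open>Invertible operators and coercivity\<close>

lemma invertible_op_compose:
  assumes "invertible_op S" "invertible_op T"
  shows "invertible_op (S o\<^sub>L T)"
proof -
  obtain S' T' where S': "S' o\<^sub>L S = id_blinfun" "S o\<^sub>L S' = id_blinfun"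
    and T': "T' o\<^sub>L T = id_blinfun" "T o\<^sub>L T' = id_blinfun"
    using assms unfolding invertible_op_def by blast
  have "(T' o\<^sub>L S') o\<^sub>L (S o\<^sub>L T) = T' o\<^sub>L (S' o\<^sub>L S) o\<^sub>L T"
    "(S o\<^sub>L T) o\<^sub>L (T' o\<^sub>L S') = S o\<^sub>L (T o\<^sub>L T') o\<^sub>L S'"
    by (simp_all only: blinfun_compose_assoc)
  then show ?thesis
    unfolding invertible_op_def using S' T' by auto
qed

lemma invertible_op_id [simp]: "invertible_op id_blinfun"
  unfolding invertible_op_def by (auto intro!: exI[of _ id_blinfun])

lemma invertible_op_scaleR:
  assumes "invertible_op T" "c \<noteq> 0"
  shows "invertible_op (c *\<^sub>R T)"
proof -
  obtain S where "S o\<^sub>L T = id_blinfun" "T o\<^sub>L S = id_blinfun"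
    using assms(1) unfolding invertible_op_def by blast
  then show ?thesis
    unfolding invertible_op_def using assms(2)
    by (intro exI[of _ "inverse c *\<^sub>R S"]) (simp add: blinfun_compose_linear)
qed

lemma invertible_op_bounded_below:
  assumes "invertible_op T"
  obtains K where "K > 0" "\<And>x. norm x \<le> K * norm (blinfun_apply T x)"
proof -
  obtain S where "S o\<^sub>L T = id_blinfun"
    using assms unfolding invertible_op_def by blast
  then have S: "blinfun_apply S (blinfun_apply T x) = x" for x
    by (metis blinfun_apply_blinfun_compose blinfun_apply_id_blinfun)
  \<comment> \<open>The added 1 keeps the constant positive when \<open>norm S\<close> is 0, as on
    the trivial space.\<close>
  have "norm x \<le> (norm S + 1) * norm (blinfun_apply T x)" for x
    using norm_blinfun[of S "blinfun_apply T x"]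
    by (simp add: S distrib_right add_increasing2)
  then show ?thesis
    by (intro that[of "norm S + 1"]) (auto intro: add_nonneg_pos)
qed

text \<open>The lower bound gives injectivity and also bounds the inverse by
  \<open>inverse c\<close>, so the open mapping theorem is avoided.\<close>

lemma invertible_op_bijI:
  assumes c: "c > 0" "\<And>x. c * norm x \<le> norm (blinfun_apply T x)"
    and surj: "\<And>y. \<exists>x. blinfun_apply T x = y"
  shows "invertible_op T"
proof -
  have inj: "x = y" if "blinfun_apply T x = blinfun_apply T y" for x y
    using c(2)[of "x - y"] that c(1)
    by (simp add: blinfun.diff_right mult_le_0_iff)
  obtain S where S: "\<And>y. blinfun_apply T (S y) = y"
    using surj by metis
  have ST: "S (blinfun_apply T x) = x" for x
    by (rule inj) (simp add: S)
  have "bounded_linear S"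
  proof (rule bounded_linear_intro)
    show "S (x + y) = S x + S y" for x y
      by (rule inj) (simp add: S blinfun.add_right)
    show "S (r *\<^sub>R x) = r *\<^sub>R S x" for r x
      by (rule inj) (simp add: S blinfun.scaleR_right)
    show "norm (S x) \<le> norm x * inverse c" for x
      using c(2)[of "S x"] c(1) by (simp add: S field_simps)
  qed
  then have "blinfun_apply (Blinfun S) = S"
    by (rule bounded_linear_Blinfun_apply)
  then show ?thesis
    unfolding invertible_op_def
    by (intro exI[of _ "Blinfun S"]) (auto intro!: blinfun_eqI simp: S ST)
qed

text \<open>Lax--Milgram: for small \<open>\<alpha> > 0\<close> the map \<open>x \<mapsto> x - \<alpha> (T x - y)\<close> is a contraction.\<close>

lemma coercive_invertible:
  fixes T :: "'a::{real_inner, complete_space} \<Rightarrow>\<^sub>L 'a"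
  assumes c: "c > 0" "\<And>x. c * (norm x)\<^sup>2 \<le> inner (blinfun_apply T x) x"
  shows "invertible_op T"
proof (rule invertible_op_bijI[OF c(1)])
  show below: "c * norm x \<le> norm (blinfun_apply T x)" for x
  proof (cases "x = 0")
    case False
    have "(c * norm x) * norm x \<le> norm (blinfun_apply T x) * norm x"
      using c(2)[of x] norm_cauchy_schwarz[of "blinfun_apply T x" x]
      by (simp add: power2_eq_square mult.assoc)
    then show ?thesis
      using False by simp
  qed simp
  show "\<exists>x. blinfun_apply T x = y" for y
  proof -
    \<comment> \<open>Adding \<open>c\<close> to the norm ensures \<open>0 < M\<close> and
      \<open>c \<le> M\<close>, hence \<open>0 \<le> q\<close>. The chosen \<open>\<alpha>\<close>
      minimises \<open>1 - 2 * \<alpha> * c + \<alpha>^2 * M^2\<close>, and \<open>q\<close> is the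
      minimum.\<close>
    define M where "M = norm T + c"
    define \<alpha> where "\<alpha> = c / M\<^sup>2"
    define q where "q = 1 - c\<^sup>2 / M\<^sup>2"
    have M: "M > 0" "c \<le> M" "norm T \<le> M"
      using c(1) by (auto simp: M_def add_nonneg_pos)
    have q: "0 \<le> q" "q < 1"
      using M c(1) by (auto simp: q_def divide_simps power_mono)
    have step: "norm (x - \<alpha> *\<^sub>R blinfun_apply T x) \<le> sqrt q * norm x" for x
    proof -
      have 1: "(norm (blinfun_apply T x))\<^sup>2 \<le> M\<^sup>2 * (norm x)\<^sup>2"
      proof -
        have "norm (blinfun_apply T x) \<le> M * norm x"
          using norm_blinfun[of T x] M(3) by (meson mult_right_mono norm_ge_zero order_trans)
        then show ?thesis
          by (metis norm_ge_zero power_mono power_mult_distrib)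
      qed
      have "(norm (x - \<alpha> *\<^sub>R blinfun_apply T x))\<^sup>2 =
          (norm x)\<^sup>2 - 2 * \<alpha> * inner (blinfun_apply T x) x + \<alpha>\<^sup>2 * (norm (blinfun_apply T x))\<^sup>2"
        unfolding power2_norm_eq_inner
        by (simp add: inner_diff_left inner_diff_right inner_commute algebra_simps power2_eq_square)
      also have "\<dots> \<le> (norm x)\<^sup>2 - 2 * \<alpha> * (c * (norm x)\<^sup>2) + \<alpha>\<^sup>2 * (M\<^sup>2 * (norm x)\<^sup>2)"
        using c M 1 by (intro add_mono diff_mono mult_left_mono) (auto simp: \<alpha>_def)
      also have "\<dots> = q * (norm x)\<^sup>2"
        using M by (simp add: \<alpha>_def q_def field_simps power2_eq_square)
      finally show ?thesis
        using q by (metis norm_ge_zero real_le_rsqrt real_sqrt_mult real_sqrt_abs abs_norm_cancel)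
    qed
    have "\<exists>!x. x - \<alpha> *\<^sub>R (blinfun_apply T x - y) = x"
    proof (rule banach_fix_type[of "sqrt q"])
      show "0 \<le> sqrt q" "sqrt q < 1"
        using q by auto
      show "\<forall>u v. dist (u - \<alpha> *\<^sub>R (blinfun_apply T u - y)) (v - \<alpha> *\<^sub>R (blinfun_apply T v - y))
        \<le> sqrt q * dist u v"
        using step[of "_ - _"]
        by (auto simp: dist_norm blinfun.diff_right algebra_simps)
    qed
    then obtain x where "x - \<alpha> *\<^sub>R (blinfun_apply T x - y) = x"
      by blast
    then have "\<alpha> *\<^sub>R (blinfun_apply T x - y) = 0"
      by simp
    then show ?thesis
      using c(1) M by (auto simp: \<alpha>_def)
  qed
qed

section \<open>Self-adjoint operators and the norm as a spectral value\<close>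

definition selfadj :: "('h::real_inner \<Rightarrow>\<^sub>L 'h) \<Rightarrow> bool" where
  "selfadj T \<longleftrightarrow> (\<forall>x y. inner (blinfun_apply T x) y = inner x (blinfun_apply T y))"

lemma selfadjD: "selfadj T \<Longrightarrow> inner (blinfun_apply T x) y = inner x (blinfun_apply T y)"
  by (simp add: selfadj_def)

lemma selfadj_id: "selfadj id_blinfun"
  and selfadj_add: "selfadj S \<Longrightarrow> selfadj T \<Longrightarrow> selfadj (S + T)"
  and selfadj_scaleR: "selfadj T \<Longrightarrow> selfadj (r *\<^sub>R T)"
  by (auto simp: selfadj_def blinfun.bilinear_simps inner_simps)

lemma selfadj_compose_commute:
  "selfadj S \<Longrightarrow> selfadj T \<Longrightarrow> S o\<^sub>L T = T o\<^sub>L S \<Longrightarrow> selfadj (S o\<^sub>L T)"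
  unfolding selfadj_def by (metis blinfun_apply_blinfun_compose)

lemma selfadj_limit:
  assumes "X \<longlonglongrightarrow> T" "\<And>n. selfadj (X n)"
  shows "selfadj T"
  unfolding selfadj_def
proof (intro allI)
  fix x y
  have lim: "(\<lambda>n. blinfun_apply (X n) z) \<longlonglongrightarrow> blinfun_apply T z" for z
    by (intro blinfun.tendsto assms(1) tendsto_const)
  have "(\<lambda>n. inner (blinfun_apply (X n) x) y) \<longlonglongrightarrow> inner (blinfun_apply T x) y"
    "(\<lambda>n. inner x (blinfun_apply (X n) y)) \<longlonglongrightarrow> inner x (blinfun_apply T y)"
    by (intro tendsto_intros lim)+
  then show "inner (blinfun_apply T x) y = inner x (blinfun_apply T y)"
    using assms(2) LIMSEQ_unique by (simp add: selfadjD)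
qed

text \<open>Write N for the norm of S. If neither N nor -N were spectral, the product S^2 - N^2 of S
  - N and S + N would be bounded below. Since |S^2 x - N^2 x|^2 \<le> N^2 (N^2 |x|^2 - |S x|^2), the
  ratio |S x| / |x| would then stay away from N, against the definition of the norm.\<close>

lemma selfadj_norm_spectrum:
  fixes S :: "'a::{real_inner, complete_space} \<Rightarrow>\<^sub>L 'a"
  assumes S: "selfadj S" and N: "norm S \<noteq> 0"
  shows "norm S \<in> op_spectrum S \<or> - norm S \<in> op_spectrum S"
proof (rule ccontr)
  let ?N = "norm S"
  assume "\<not> ?thesis"
  then have "invertible_op ((S - ?N *\<^sub>R id_blinfun) o\<^sub>L (S - (- ?N) *\<^sub>R id_blinfun))"
    by (intro invertible_op_compose) (auto simp: op_spectrum_def)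
  then obtain K where K: "K > 0" "\<And>x. norm x \<le> K * norm
      (blinfun_apply ((S - ?N *\<^sub>R id_blinfun) o\<^sub>L (S - (- ?N) *\<^sub>R id_blinfun)) x)"
    by (rule invertible_op_bounded_below) blast
  have Npos: "?N > 0"
    using N by simp
  have main: "(norm (blinfun_apply S x))\<^sup>2 \<le> (?N\<^sup>2 - 1 / (K * ?N)\<^sup>2) * (norm x)\<^sup>2" for x
  proof -
    let ?y = "blinfun_apply S (blinfun_apply S x)"
    have eq: "blinfun_apply ((S - ?N *\<^sub>R id_blinfun) o\<^sub>L (S - (- ?N) *\<^sub>R id_blinfun)) x
      = ?y - ?N\<^sup>2 *\<^sub>R x"
      by (simp add: blinfun.bilinear_simps algebra_simps power2_eq_square)
    have "norm ?y \<le> ?N * norm (blinfun_apply S x)"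
      by (rule norm_blinfun)
    then have y: "(norm ?y)\<^sup>2 \<le> ?N\<^sup>2 * (norm (blinfun_apply S x))\<^sup>2"
      by (metis norm_ge_zero power_mono power_mult_distrib)
    have "(norm (?y - ?N\<^sup>2 *\<^sub>R x))\<^sup>2 = (norm ?y)\<^sup>2 - 2 * ?N\<^sup>2 * inner ?y x + ?N^4 * (norm x)\<^sup>2"
      unfolding power2_norm_eq_inner
      by (simp add: inner_diff_left inner_diff_right inner_commute algebra_simps
          power2_eq_square power4_eq_xxxx)
    also have "inner ?y x = (norm (blinfun_apply S x))\<^sup>2"
      using selfadjD[OF S, of "blinfun_apply S x" x] by (simp add: power2_norm_eq_inner)
    finally have "(norm (?y - ?N\<^sup>2 *\<^sub>R x))\<^sup>2
        \<le> ?N\<^sup>2 * (?N\<^sup>2 * (norm x)\<^sup>2 - (norm (blinfun_apply S x))\<^sup>2)"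
      using y by (simp add: algebra_simps power2_eq_square power4_eq_xxxx)
    moreover have "(norm x)\<^sup>2 \<le> K\<^sup>2 * (norm (?y - ?N\<^sup>2 *\<^sub>R x))\<^sup>2"
      using K(2)[of x] unfolding eq by (metis norm_ge_zero power_mono power_mult_distrib)
    ultimately have "(norm x)\<^sup>2 \<le> K\<^sup>2 * (?N\<^sup>2 * (?N\<^sup>2 * (norm x)\<^sup>2 - (norm (blinfun_apply S x))\<^sup>2))"
      using K(1) by (meson mult_left_mono order_trans zero_le_power2)
    then show ?thesis
      using K(1) Npos by (simp add: field_simps power_mult_distrib)
  qed
  \<comment> \<open>The \<open>max 0\<close> makes the bound nonnegative without examining the sign
    of the difference.\<close>
  define \<rho> where "\<rho> = sqrt (max 0 (?N\<^sup>2 - 1 / (K * ?N)\<^sup>2))"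
  have "norm S \<le> \<rho>"
  proof (rule norm_blinfun_bound)
    fix x
    have "(norm (blinfun_apply S x))\<^sup>2 \<le> max 0 (?N\<^sup>2 - 1 / (K * ?N)\<^sup>2) * (norm x)\<^sup>2"
      using main[of x] by (meson max.cobounded2 mult_right_mono order_trans zero_le_power2)
    then have "norm (blinfun_apply S x) \<le> sqrt (max 0 (?N\<^sup>2 - 1 / (K * ?N)\<^sup>2) * (norm x)\<^sup>2)"
      by (rule real_le_rsqrt)
    then show "norm (blinfun_apply S x) \<le> \<rho> * norm x"
      by (simp add: \<rho>_def real_sqrt_mult)
  qed (simp add: \<rho>_def)
  also have "\<rho> < sqrt (?N\<^sup>2)"
    unfolding \<rho>_def using K(1) Npos by (intro real_sqrt_less_mono) auto
  finally show False
    by simp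
qed

section \<open>Polynomials of a self-adjoint operator\<close>

lemma poly_op_0 [simp]: "poly_op 0 T = 0"
  by (simp add: poly_op_def)

text \<open>This Horner recursion reduces the algebra of \<open>poly_op\<close> to induction over
  \<open>pCons\<close>. The case \<open>p = 0\<close> is separate because the degree does not
  increase there.\<close>

lemma poly_op_pCons [simp]: "poly_op (pCons a p) T = a *\<^sub>R id_blinfun + (T o\<^sub>L poly_op p T)"
proof (cases "p = 0")
  case True
  then show ?thesis
    by (simp add: poly_op_def)
next
  case False
  then show ?thesis
    by (simp add: poly_op_def sum.atMost_Suc_shift blinfun_compose_linear del: sum.atMost_Suc)
qed

lemma poly_op_add: "poly_op (p + q) T = poly_op p T + poly_op q T"
  by (induction p q rule: poly_induct2)
    (simp_all add: blinfun_compose_linear scaleR_add_left)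

lemma poly_op_smult: "poly_op (smult c p) T = c *\<^sub>R poly_op p T"
  by (induction p) (simp_all add: blinfun_compose_linear scaleR_add_right)

lemma poly_op_diff: "poly_op (p - q) T = poly_op p T - poly_op q T"
  using poly_op_add[of "p - q" q T] by simp

lemma poly_op_mult: "poly_op (p * q) T = poly_op p T o\<^sub>L poly_op q T"
  by (induction p)
    (simp_all add: poly_op_add poly_op_smult blinfun_compose_linear blinfun_compose_assoc)

lemma poly_op_commute:
  assumes "T o\<^sub>L S = S o\<^sub>L T"
  shows "poly_op p T o\<^sub>L S = S o\<^sub>L poly_op p T"
proof (induction p)
  case (pCons a p)
  have "(T o\<^sub>L poly_op p T) o\<^sub>L S = T o\<^sub>L (S o\<^sub>L poly_op p T)"
    by (simp only: blinfun_compose_assoc pCons)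
  also have "\<dots> = S o\<^sub>L (T o\<^sub>L poly_op p T)"
    by (metis assms blinfun_compose_assoc)
  finally show ?case
    by (simp add: blinfun_compose_linear)
qed simp

lemma selfadj_poly_op:
  assumes "selfadj T"
  shows "selfadj (poly_op p T)"
proof (induction p)
  case 0
  then show ?case
    by (simp add: selfadj_def)
next
  case (pCons a p)
  have "selfadj (T o\<^sub>L poly_op p T)"
    by (rule selfadj_compose_commute[OF assms pCons(2)]) (simp add: poly_op_commute)
  then show ?case
    by (simp add: selfadj_add selfadj_scaleR selfadj_id)
qed

text \<open>Take a complex zero \<open>z\<close> of \<open>p\<close>. If it is real, it splits off a
  linear factor. Otherwise divide by (x - Re z)^2 + (Im z)^2: the remainder c + d x has real
  coefficients and vanishes at the nonreal \<open>z\<close>, so c = d = 0.\<close>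

lemma real_poly_linear_or_quadratic_factor:
  fixes p :: "real poly"
  assumes "degree p > 0"
  obtains (linear) a r where "p = [:-a, 1:] * r"
    | (quadratic) a b r where "b \<noteq> 0" "p = [:a\<^sup>2 + b\<^sup>2, -2 * a, 1:] * r"
proof -
  have map_mult: "map_poly complex_of_real (f * g) = map_poly of_real f * map_poly of_real g" for f g
    by (rule poly_eqI) (simp add: coeff_map_poly coeff_mult)
  have map_add: "map_poly complex_of_real (f + g) = map_poly of_real f + map_poly of_real g" for f g
    by (rule poly_eqI) (simp add: coeff_map_poly)
  have "degree (map_poly complex_of_real p) = degree p"
    by (rule map_poly_degree_eq) (use assms in auto)
  then have "\<not> constant (poly (map_poly complex_of_real p))"
    using assms by (simp add: constant_degree)
  then obtain z where z: "poly (map_poly complex_of_real p) z = 0"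
    using fundamental_theorem_of_algebra by blast
  show thesis
  proof (cases "Im z = 0")
    case True
    then have "z = of_real (Re z)"
      by (simp add: complex_eq_iff)
    moreover have "poly (map_poly complex_of_real p) (of_real x) = of_real (poly p x)" for x
      by (induction p) (simp_all add: map_poly_pCons)
    ultimately have "poly p (Re z) = 0"
      using z by (metis of_real_eq_0_iff)
    then show thesis
      using linear by (metis dvdE poly_eq_0_iff_dvd)
  next
    case False
    let ?s = "[:(Re z)\<^sup>2 + (Im z)\<^sup>2, - 2 * Re z, 1:]"
    obtain c d where cd: "p mod ?s = [:c, d:]"
    proof -
      have "degree (p mod ?s) < 2"
        using degree_mod_less'[of ?s p] by (cases "p mod ?s = 0") auto
      then have "p mod ?s = [:coeff (p mod ?s) 0, coeff (p mod ?s) 1:]"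
        by (intro poly_eqI) (auto simp: coeff_pCons coeff_eq_0 split: nat.split)
      then show ?thesis
        by (rule that)
    qed
    have "poly (map_poly of_real ?s) z = 0"
      by (simp add: map_poly_pCons complex_eq_iff power2_eq_square algebra_simps)
    moreover have "p = ?s * (p div ?s) + [:c, d:]"
      by (metis cd mult_div_mod_eq)
    ultimately have "poly (map_poly complex_of_real [:c, d:]) z = 0"
      using z by (metis add_0 map_add map_mult mult_zero_left poly_add poly_mult)
    then have "d = 0" "c = 0"
      using False by (auto simp: map_poly_pCons complex_eq_iff)
    then show thesis
      using quadratic[of "Im z" "Re z" "p div ?s"] False \<open>p = _ + _\<close> by simp
  qed
qed

text \<open>Induction on the degree, splitting off one real factor at a time. The zero of a linear
  factor is a zero of \<open>q\<close>, hence no spectral value, so that factor is invertible at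
  \<open>T\<close>. A quadratic factor is coercive there: its form at x is |T x - a x|^2 + b^2
  |x|^2.\<close>

lemma poly_op_invertible:
  fixes T :: "'a::{real_inner, complete_space} \<Rightarrow>\<^sub>L 'a"
  assumes T: "selfadj T"
  shows "q \<noteq> 0 \<Longrightarrow> (\<And>x. x \<in> op_spectrum T \<Longrightarrow> poly q x \<noteq> 0) \<Longrightarrow> invertible_op (poly_op q T)"
proof (induction "degree q" arbitrary: q rule: less_induct)
  case less
  show ?case
  proof (cases "degree q = 0")
    case True
    then obtain c where "q = [:c:]"
      by (metis degree_eq_zeroE)
    then show ?thesis
      using less.prems by (simp add: invertible_op_scaleR)
  next
    case False
    then have "degree q > 0"
      by simp
    then show ?thesis
    proof (cases rule: real_poly_linear_or_quadratic_factor)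
      case (linear a r)
      have r: "r \<noteq> 0"
        using linear less.prems(1) by auto
      have "degree q = Suc (degree r)"
        unfolding linear by (subst degree_mult_eq) (use r in auto)
      then have "invertible_op (poly_op r T)"
        using less.prems r linear by (intro less.hyps) auto
      moreover have "a \<notin> op_spectrum T"
        using less.prems(2)[of a] linear by auto
      then have "invertible_op (poly_op [:-a, 1:] T)"
        by (simp add: op_spectrum_def)
      ultimately show ?thesis
        unfolding linear poly_op_mult by (rule invertible_op_compose[rotated])
    next
      case (quadratic a b r)
      let ?s = "[:a\<^sup>2 + b\<^sup>2, -2 * a, 1:]"
      have r: "r \<noteq> 0"
        using quadratic less.prems(1) by auto
      have "degree q = Suc (Suc (degree r))"
        unfolding quadratic by (subst degree_mult_eq) (use r in auto)
      moreover have "poly q x = poly ?s x * poly r x" for x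
        by (simp only: quadratic poly_mult)
      ultimately have "invertible_op (poly_op r T)"
        using less.prems r by (intro less.hyps) auto
      moreover have "invertible_op (poly_op ?s T)"
      proof (rule coercive_invertible[of "b\<^sup>2"])
        fix x
        let ?y = "blinfun_apply T x"
        have "inner (blinfun_apply T ?y) x = inner ?y ?y"
          using selfadjD[OF T, of ?y x] by simp
        then have "inner (blinfun_apply (poly_op ?s T) x) x =
            inner (?y - a *\<^sub>R x) (?y - a *\<^sub>R x) + b\<^sup>2 * inner x x"
          by (simp add: blinfun.bilinear_simps inner_simps inner_commute algebra_simps power2_eq_square)
        then show "b\<^sup>2 * (norm x)\<^sup>2 \<le> inner (blinfun_apply (poly_op ?s T) x) x"
          by (simp add: power2_norm_eq_inner)
      qed (use quadratic in auto)
      ultimately show ?thesis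
        unfolding quadratic poly_op_mult by (rule invertible_op_compose[rotated])
    qed
  qed
qed

text \<open>The operator \<open>S\<close> only witnesses that the space is nontrivial; on the
  trivial space every operator is invertible and all spectra are empty. An empty spectrum forces
  \<open>T = 0\<close>, as plus or minus the norm would lie in it, and then 0 is invertible.\<close>

lemma op_spectrum_nonempty:
  fixes T S :: "'a::{real_inner, complete_space} \<Rightarrow>\<^sub>L 'a"
  assumes "selfadj T" "S \<noteq> 0"
  shows "op_spectrum T \<noteq> {}"
proof
  assume empty: "op_spectrum T = {}"
  then have "T = 0"
    using selfadj_norm_spectrum[OF assms(1)] by auto
  then have "invertible_op (0 :: 'a \<Rightarrow>\<^sub>L 'a)"
    using empty by (auto simp: op_spectrum_def dest: spec[of _ 0])
  then have "id_blinfun = (0 :: 'a \<Rightarrow>\<^sub>L 'a)"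
    by (auto simp: invertible_op_def)
  then have "S = 0"
    by (metis blinfun_compose_id(2) blinfun_compose_zero(2))
  with assms(2) show False ..
qed

text \<open>One of the two numbers r = \<plusminus> norm p(T) lies in the spectrum of p(T). If p
  missed the value r on the spectrum of T, then p - r would have no zeros there, and p(T) - r would
  be invertible.\<close>

lemma poly_op_norm_attained:
  fixes T :: "'a::{real_inner, complete_space} \<Rightarrow>\<^sub>L 'a"
  assumes T: "selfadj T" and "poly_op p T \<noteq> 0"
  shows "\<exists>x\<in>op_spectrum T. norm (poly_op p T) = \<bar>poly p x\<bar>"
proof -
  obtain r where r: "r \<in> op_spectrum (poly_op p T)" "\<bar>r\<bar> = norm (poly_op p T)"
    using selfadj_norm_spectrum[OF selfadj_poly_op[OF T], of p] assms(2) by fastforce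
  have eq: "poly_op (p - [:r:]) T = poly_op p T - r *\<^sub>R id_blinfun"
    by (simp add: poly_op_diff)
  show ?thesis
  proof (rule ccontr)
    assume none: "\<not> ?thesis"
    then have "poly (p - [:r:]) x \<noteq> 0" if "x \<in> op_spectrum T" for x
      using r(2) that by auto
    \<comment> \<open>Since p(T) is not 0, the spectrum of \<open>T\<close> has a point, and
      \<open>p - [:r:]\<close> does not vanish at it.\<close>
    moreover have "p - [:r:] \<noteq> 0"
      using calculation op_spectrum_nonempty[OF assms] by fastforce
    ultimately have "invertible_op (poly_op p T - r *\<^sub>R id_blinfun)"
      using poly_op_invertible[OF T, of "p - [:r:]"] eq by auto
    then show False
      using r(1) by (simp add: op_spectrum_def)
  qed
qed

section \<open>Continuous functional calculus\<close>

lemma Weierstrass_real_poly: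
  fixes f :: "real \<Rightarrow> real"
  assumes "continuous_on {a..b} f"
  obtains p where "uniform_limit {a..b} (\<lambda>n. poly (p n)) f sequentially"
proof -
  obtain g where g: "uniform_limit {a..b} g f sequentially" "\<And>n. polynomial_function (g n :: real \<Rightarrow> real)"
    using Stone_Weierstrass_uniform_limit[OF compact_Icc assms] by blast
  have "\<exists>p. g n = poly p" for n
  proof -
    obtain c :: "nat \<Rightarrow> real" and k where "g n = (\<lambda>x. \<Sum>i\<le>k. c i * x ^ i)"
      using g(2)[of n] real_polynomial_function_eq real_polynomial_function_iff_sum by blast
    then show ?thesis
      by (intro exI[of _ "\<Sum>i\<le>k. monom (c i) i"]) (auto simp: poly_sum poly_monom)
  qed
  then obtain p where "\<And>n. g n = poly (p n)"
    by metis
  then have "g = (\<lambda>n. poly (p n))"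
    by auto
  then show thesis
    using g(1) that by blast
qed

text \<open>An enclosing interval stands in for the spectrum: Weierstrass approximation takes place
  on it, and it may be enlarged to suit several functions or operators at once.\<close>

locale spectral_interval =
  fixes T :: "'a::{real_inner, complete_space} \<Rightarrow>\<^sub>L 'a" and a b :: real
  assumes selfadj: "selfadj T" and spectrum: "op_spectrum T \<subseteq> {a..b}"
begin

lemma norm_poly_op_le:
  assumes "\<And>x. x \<in> op_spectrum T \<Longrightarrow> \<bar>poly p x\<bar> \<le> e" "0 \<le> e"
  shows "norm (poly_op p T) \<le> e"
  using poly_op_norm_attained[OF selfadj, of p] assms by (cases "poly_op p T = 0") auto

text \<open>This justifies the definite description in \<open>fun_calc\<close>. By the norm bound, a
  Weierstrass sequence \<open>q\<close> yields a Cauchy sequence of operators with limit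
  \<open>F\<close>. Any other admissible sequence differs from \<open>q\<close> by polynomials
  tending to 0 uniformly on the spectrum, so it has the same limit, and \<open>q\<close> itself
  forces uniqueness.\<close>

lemma fun_calc_limit_spectrum:
  assumes f: "continuous_on {a..b} f"
    and p: "uniform_limit (op_spectrum T) (\<lambda>n. poly (p n)) f sequentially"
  shows "(\<lambda>n. poly_op (p n) T) \<longlonglongrightarrow> fun_calc T f"
proof -
  obtain q where "uniform_limit {a..b} (\<lambda>n. poly (q n)) f sequentially"
    using Weierstrass_real_poly[OF f] .
  then have q: "uniform_limit (op_spectrum T) (\<lambda>n. poly (q n)) f sequentially"
    using spectrum by (rule uniform_limit_on_subset)
  have "Cauchy (\<lambda>n. poly_op (q n) T)"
  proof (rule CauchyI)
    fix e :: real
    assume "e > 0"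
    have "uniformly_Cauchy_on (op_spectrum T) (\<lambda>n. poly (q n))"
      using q by (intro uniformly_convergent_Cauchy uniformly_convergentI)
    then obtain M where M: "\<And>x m n. x \<in> op_spectrum T \<Longrightarrow> m \<ge> M \<Longrightarrow> n \<ge> M \<Longrightarrow>
        dist (poly (q m) x) (poly (q n) x) < e / 2"
      using \<open>e > 0\<close> unfolding uniformly_Cauchy_on_def by (metis half_gt_zero)
    have "norm (poly_op (q m) T - poly_op (q n) T) < e" if "m \<ge> M" "n \<ge> M" for m n
    proof -
      have "norm (poly_op (q m - q n) T) \<le> e / 2"
        using M[OF _ that] \<open>e > 0\<close> by (intro norm_poly_op_le) (auto simp: dist_real_def less_imp_le)
      then show ?thesis
        using \<open>e > 0\<close> by (simp add: poly_op_diff)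
    qed
    then show "\<exists>M. \<forall>m\<ge>M. \<forall>n\<ge>M. norm (poly_op (q m) T - poly_op (q n) T) < e"
      by blast
  qed
  then obtain F where F: "(\<lambda>n. poly_op (q n) T) \<longlonglongrightarrow> F"
    using blinfun_Cauchy_convergent convergent_def by blast
  have lim: "(\<lambda>n. poly_op (r n) T) \<longlonglongrightarrow> F"
    if r: "uniform_limit (op_spectrum T) (\<lambda>n. poly (r n)) f sequentially" for r
  proof -
    have u: "uniform_limit (op_spectrum T) (\<lambda>n x. poly (r n) x - poly (q n) x) (\<lambda>x. f x - f x) sequentially"
      by (intro uniform_limit_intros r q)
    have "(\<lambda>n. poly_op (r n) T - poly_op (q n) T) \<longlonglongrightarrow> 0"
    proof (rule tendstoI)
      fix e :: real
      assume "e > 0"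
      then have "\<forall>\<^sub>F n in sequentially. \<forall>x\<in>op_spectrum T. \<bar>poly (r n - q n) x\<bar> < e / 2"
        using uniform_limitD[OF u, of "e / 2"] by (simp add: dist_real_def)
      then show "\<forall>\<^sub>F n in sequentially. dist (poly_op (r n) T - poly_op (q n) T) 0 < e"
      proof eventually_elim
        case (elim n)
        then have "norm (poly_op (r n - q n) T) \<le> e / 2"
          using \<open>e > 0\<close> by (intro norm_poly_op_le) (auto simp: less_imp_le)
        then show ?case
          using \<open>e > 0\<close> by (simp add: poly_op_diff)
      qed
    qed
    from tendsto_add[OF this F] show ?thesis
      by simp
  qed
  have "fun_calc T f = F"
    unfolding fun_calc_def
  proof (rule the_equality)
    fix G
    assume "\<forall>p. uniform_limit (op_spectrum T) (\<lambda>n. poly (p n)) f sequentially \<longrightarrow>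
      (\<lambda>n. poly_op (p n) T) \<longlonglongrightarrow> G"
    then show "G = F"
      using q F LIMSEQ_unique by blast
  qed (use lim in blast)
  then show ?thesis
    using lim p by blast
qed

lemma fun_calc_limit:
  assumes "continuous_on {a..b} f" "uniform_limit {a..b} (\<lambda>n. poly (p n)) f sequentially"
  shows "(\<lambda>n. poly_op (p n) T) \<longlonglongrightarrow> fun_calc T f"
  using assms spectrum by (blast intro: fun_calc_limit_spectrum uniform_limit_on_subset)

lemma fun_calc_poly: "fun_calc T (poly p) = poly_op p T"
  by (rule LIMSEQ_unique[OF fun_calc_limit[of _ "\<lambda>_. p"]])
    (auto intro!: uniform_limit_intros continuous_intros)

lemma fun_calc_const: "fun_calc T (\<lambda>x. c) = c *\<^sub>R id_blinfun"
proof -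
  have "poly [:c:] = (\<lambda>x. c)"
    by auto
  then show ?thesis
    using fun_calc_poly[of "[:c:]"] by simp
qed

lemma fun_calc_ident: "fun_calc T (\<lambda>x. x) = T"
proof -
  have "poly [:0, 1:] = (\<lambda>x::real. x)"
    by (simp add: fun_eq_iff)
  then show ?thesis
    using fun_calc_poly[of "[:0, 1:]"] by simp
qed

lemma fun_calc_add:
  assumes "continuous_on {a..b} f" "continuous_on {a..b} g"
  shows "fun_calc T (\<lambda>x. f x + g x) = fun_calc T f + fun_calc T g"
proof -
  obtain p where p: "uniform_limit {a..b} (\<lambda>n. poly (p n)) f sequentially"
    using Weierstrass_real_poly[OF assms(1)] .
  obtain q where q: "uniform_limit {a..b} (\<lambda>n. poly (q n)) g sequentially"
    using Weierstrass_real_poly[OF assms(2)] .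
  have "(\<lambda>n. poly_op (p n + q n) T) \<longlonglongrightarrow> fun_calc T (\<lambda>x. f x + g x)"
    using assms uniform_limit_add[OF p q]
    by (intro fun_calc_limit continuous_intros) (simp_all add: poly_add[abs_def])
  moreover have "(\<lambda>n. poly_op (p n + q n) T) \<longlonglongrightarrow> fun_calc T f + fun_calc T g"
    unfolding poly_op_add using assms p q by (intro tendsto_add fun_calc_limit)
  ultimately show ?thesis
    by (rule LIMSEQ_unique)
qed

lemma fun_calc_mult:
  assumes "continuous_on {a..b} f" "continuous_on {a..b} g"
  shows "fun_calc T (\<lambda>x. f x * g x) = fun_calc T f o\<^sub>L fun_calc T g"
proof -
  obtain p where p: "uniform_limit {a..b} (\<lambda>n. poly (p n)) f sequentially"
    using Weierstrass_real_poly[OF assms(1)] .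
  obtain q where q: "uniform_limit {a..b} (\<lambda>n. poly (q n)) g sequentially"
    using Weierstrass_real_poly[OF assms(2)] .
  \<comment> \<open>Products of uniformly convergent sequences converge uniformly once both limits
    are bounded.\<close>
  have bdd: "bounded (f ` {a..b})" "bounded (g ` {a..b})"
    using assms by (auto intro!: compact_imp_bounded compact_continuous_image)
  have "(\<lambda>n. poly_op (p n * q n) T) \<longlonglongrightarrow> fun_calc T (\<lambda>x. f x * g x)"
    using assms uniform_lim_mult[OF p q bdd]
    by (intro fun_calc_limit continuous_intros) (simp_all add: poly_mult[abs_def])
  moreover have "(\<lambda>n. poly_op (p n * q n) T) \<longlonglongrightarrow> (fun_calc T f o\<^sub>L fun_calc T g)"
    unfolding poly_op_mult using assms p q
    by (intro bounded_bilinear.tendsto[OF bounded_bilinear_blinfun_compose] fun_calc_limit)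
  ultimately show ?thesis
    by (rule LIMSEQ_unique)
qed

text \<open>The polynomial case of the composition rule, from which \<open>fun_calc_compose\<close>
  follows by approximation.\<close>

lemma poly_op_fun_calc:
  assumes f: "continuous_on {a..b} f"
  shows "poly_op p (fun_calc T f) = fun_calc T (\<lambda>x. poly p (f x))"
proof (induction p)
  case 0
  then show ?case
    by (simp add: fun_calc_const)
next
  case (pCons c p)
  have "fun_calc T (\<lambda>x. poly (pCons c p) (f x)) =
      fun_calc T (\<lambda>x. c) + fun_calc T (\<lambda>x. f x * poly p (f x))"
    by (subst fun_calc_add[symmetric]) (auto intro!: continuous_intros f)
  also have "fun_calc T (\<lambda>x. f x * poly p (f x)) = fun_calc T f o\<^sub>L fun_calc T (\<lambda>x. poly p (f x))"
    by (intro fun_calc_mult continuous_intros f)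
  finally show ?case
    by (simp add: pCons fun_calc_const)
qed

text \<open>The norm bound for polynomials passes to the limit; the slack \<open>d\<close> absorbs
  the approximation errors of both functions.\<close>

lemma norm_fun_calc_diff_le:
  assumes f: "continuous_on {a..b} f" and g: "continuous_on {a..b} g"
    and e: "\<And>x. x \<in> {a..b} \<Longrightarrow> \<bar>f x - g x\<bar> \<le> e" "0 \<le> e"
  shows "norm (fun_calc T f - fun_calc T g) \<le> e"
proof (rule field_le_epsilon)
  fix d :: real
  assume "d > 0"
  obtain p where p: "uniform_limit {a..b} (\<lambda>n. poly (p n)) f sequentially"
    using Weierstrass_real_poly[OF f] .
  obtain q where q: "uniform_limit {a..b} (\<lambda>n. poly (q n)) g sequentially"
    using Weierstrass_real_poly[OF g] .
  have lim: "(\<lambda>n. norm (poly_op (p n) T - poly_op (q n) T)) \<longlonglongrightarrow> norm (fun_calc T f - fun_calc T g)"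
    by (intro tendsto_intros fun_calc_limit f g p q)
  have u: "uniform_limit {a..b} (\<lambda>n x. poly (p n) x - poly (q n) x) (\<lambda>x. f x - g x) sequentially"
    by (intro uniform_limit_intros p q)
  have "\<forall>\<^sub>F n in sequentially. norm (poly_op (p n) T - poly_op (q n) T) \<le> e + d"
    using uniform_limitD[OF u \<open>d > 0\<close>]
  proof eventually_elim
    case (elim n)
    have "norm (poly_op (p n - q n) T) \<le> e + d"
    proof (rule norm_poly_op_le)
      fix x assume "x \<in> op_spectrum T"
      then have "x \<in> {a..b}"
        using spectrum by blast
      then have "\<bar>(poly (p n) x - poly (q n) x) - (f x - g x)\<bar> < d"
        using elim by (simp add: dist_real_def)
      then show "\<bar>poly (p n - q n) x\<bar> \<le> e + d"
        using e(1)[OF \<open>x \<in> {a..b}\<close>] unfolding poly_diff by linarith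
    qed (use e(2) \<open>d > 0\<close> in simp)
    then show ?case
      by (simp add: poly_op_diff)
  qed
  then show "norm (fun_calc T f - fun_calc T g) \<le> e + d"
    using lim by (intro tendsto_upperbound[OF lim]) auto
qed

text \<open>The preceding bound with e = 0. It makes the values of a total function such as
  \<open>powr\<close> outside the interval irrelevant.\<close>

lemma fun_calc_cong:
  assumes "continuous_on {a..b} f" "\<And>x. x \<in> {a..b} \<Longrightarrow> f x = g x"
  shows "fun_calc T f = fun_calc T g"
proof -
  have "continuous_on {a..b} g"
    using assms continuous_on_cong by metis
  then have "norm (fun_calc T f - fun_calc T g) \<le> 0"
    using assms by (intro norm_fun_calc_diff_le) auto
  then show ?thesis
    by simp
qed

text \<open>If polynomials p_n tend to g uniformly on \<open>{c..d}\<close>, then p_n(f(x)) tends to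
  g(f(x)) uniformly on \<open>{a..b}\<close>. Requiring \<open>{c..d}\<close> to contain both the
  image of \<open>f\<close> and the spectrum of f(T) takes the place of a spectral mapping
  theorem.\<close>

lemma fun_calc_compose:
  assumes f: "continuous_on {a..b} f" "f ` {a..b} \<subseteq> {c..d}" and g: "continuous_on {c..d} g"
    and S: "spectral_interval (fun_calc T f) c d"
  shows "fun_calc (fun_calc T f) g = fun_calc T (\<lambda>x. g (f x))"
proof -
  have gf: "continuous_on {a..b} (\<lambda>x. g (f x))"
    by (rule continuous_on_compose2[OF g f])
  obtain p where p: "uniform_limit {c..d} (\<lambda>n. poly (p n)) g sequentially"
    using Weierstrass_real_poly[OF g] .
  have "(\<lambda>n. poly_op (p n) (fun_calc T f)) \<longlonglongrightarrow> fun_calc (fun_calc T f) g"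
    by (rule spectral_interval.fun_calc_limit[OF S g p])
  moreover have "(\<lambda>n. poly_op (p n) (fun_calc T f)) \<longlonglongrightarrow> fun_calc T (\<lambda>x. g (f x))"
  proof (rule tendstoI)
    fix e :: real
    assume "e > 0"
    then have "\<forall>\<^sub>F n in sequentially. \<forall>y\<in>{c..d}. dist (poly (p n) y) (g y) < e / 2"
      using uniform_limitD[OF p, of "e / 2"] by simp
    then show "\<forall>\<^sub>F n in sequentially. dist (poly_op (p n) (fun_calc T f)) (fun_calc T (\<lambda>x. g (f x))) < e"
    proof eventually_elim
      case (elim n)
      have "norm (fun_calc T (\<lambda>x. poly (p n) (f x)) - fun_calc T (\<lambda>x. g (f x))) \<le> e / 2"
      proof (rule norm_fun_calc_diff_le[OF _ gf])
        fix x assume "x \<in> {a..b}"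
        then have "f x \<in> {c..d}"
          using f(2) by blast
        then show "\<bar>poly (p n) (f x) - g (f x)\<bar> \<le> e / 2"
          using elim by (auto simp: dist_real_def intro: less_imp_le)
      qed (use \<open>e > 0\<close> in \<open>auto intro!: continuous_intros f(1)\<close>)
      then show ?case
        using \<open>e > 0\<close> by (simp add: poly_op_fun_calc[OF f(1)] dist_norm)
    qed
  qed
  ultimately show ?thesis
    by (rule LIMSEQ_unique)
qed

lemma selfadj_fun_calc:
  assumes "continuous_on {a..b} f"
  shows "selfadj (fun_calc T f)"
proof -
  obtain p where p: "uniform_limit {a..b} (\<lambda>n. poly (p n)) f sequentially"
    using Weierstrass_real_poly[OF assms] .
  show ?thesis
    by (rule selfadj_limit[OF fun_calc_limit[OF assms p]]) (rule selfadj_poly_op[OF selfadj])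
qed

lemma fun_calc_commute:
  assumes "continuous_on {a..b} f" "T o\<^sub>L S = S o\<^sub>L T"
  shows "fun_calc T f o\<^sub>L S = S o\<^sub>L fun_calc T f"
proof -
  obtain p where p: "uniform_limit {a..b} (\<lambda>n. poly (p n)) f sequentially"
    using Weierstrass_real_poly[OF assms(1)] .
  note lim = fun_calc_limit[OF assms(1) p]
  have "(\<lambda>n. poly_op (p n) T o\<^sub>L S) \<longlonglongrightarrow> (fun_calc T f o\<^sub>L S)"
    "(\<lambda>n. S o\<^sub>L poly_op (p n) T) \<longlonglongrightarrow> (S o\<^sub>L fun_calc T f)"
    by (intro bounded_bilinear.tendsto[OF bounded_bilinear_blinfun_compose] lim tendsto_const)+
  then show ?thesis
    using LIMSEQ_unique by (simp add: poly_op_commute[OF assms(2)])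
qed

end

section \<open>Similar operators\<close>

lemma poly_op_similar:
  fixes T U V :: "'a::real_normed_vector \<Rightarrow>\<^sub>L 'a"
  assumes "U o\<^sub>L V = id_blinfun"
    and "V o\<^sub>L U = id_blinfun"
  shows "poly_op p (V o\<^sub>L T o\<^sub>L U) = V o\<^sub>L poly_op p T o\<^sub>L U"
proof (induction p)
  case (pCons c p)
  have "(V o\<^sub>L T o\<^sub>L U) o\<^sub>L (V o\<^sub>L poly_op p T o\<^sub>L U) = V o\<^sub>L (T o\<^sub>L ((U o\<^sub>L V) o\<^sub>L (poly_op p T o\<^sub>L U)))"
    by (simp only: blinfun_compose_assoc)
  also have "\<dots> = V o\<^sub>L (T o\<^sub>L poly_op p T) o\<^sub>L U"
    by (simp add: assms blinfun_compose_assoc)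
  finally have step: "(V o\<^sub>L T o\<^sub>L U) o\<^sub>L (V o\<^sub>L poly_op p T o\<^sub>L U) = V o\<^sub>L (T o\<^sub>L poly_op p T) o\<^sub>L U" .
  have "poly_op (pCons c p) (V o\<^sub>L T o\<^sub>L U) = c *\<^sub>R id_blinfun + (V o\<^sub>L (T o\<^sub>L poly_op p T) o\<^sub>L U)"
    by (simp only: poly_op_pCons pCons step)
  then show ?case
    by (simp add: blinfun_compose_linear assms)
qed simp

lemma invertible_op_similar:
  fixes T U V :: "'a::real_normed_vector \<Rightarrow>\<^sub>L 'a"
  assumes UV: "U o\<^sub>L V = id_blinfun" "V o\<^sub>L U = id_blinfun"
  shows "invertible_op (V o\<^sub>L T o\<^sub>L U) \<longleftrightarrow> invertible_op T"
proof -
  have inv: "invertible_op U" "invertible_op V"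
    using UV by (auto simp: invertible_op_def)
  have "U o\<^sub>L (V o\<^sub>L T o\<^sub>L U) o\<^sub>L V = (U o\<^sub>L V) o\<^sub>L T o\<^sub>L (U o\<^sub>L V)"
    by (simp only: blinfun_compose_assoc)
  also have "\<dots> = T"
    by (simp add: UV)
  finally show ?thesis
    using inv invertible_op_compose by metis
qed

lemma op_spectrum_similar:
  fixes T U V :: "'a::real_normed_vector \<Rightarrow>\<^sub>L 'a"
  assumes UV: "U o\<^sub>L V = id_blinfun" "V o\<^sub>L U = id_blinfun"
  shows "op_spectrum (V o\<^sub>L T o\<^sub>L U) = op_spectrum T"
proof -
  have "(V o\<^sub>L T o\<^sub>L U) - r *\<^sub>R id_blinfun = V o\<^sub>L (T - r *\<^sub>R id_blinfun) o\<^sub>L U" for r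
    by (simp add: blinfun_compose_linear UV)
  then show ?thesis
    unfolding op_spectrum_def by (simp add: invertible_op_similar[OF UV])
qed

text \<open>Similar operators have the same spectrum, so one approximating sequence serves both.
  Self-adjointness of the transformed operator is a separate hypothesis, because \<open>V\<close> is
  the inverse of \<open>U\<close> but need not be its adjoint.\<close>

lemma (in spectral_interval) fun_calc_similar:
  fixes U V :: "'a \<Rightarrow>\<^sub>L 'a"
  assumes f: "continuous_on {a..b} f"
    and UV: "U o\<^sub>L V = id_blinfun" "V o\<^sub>L U = id_blinfun"
    and S: "selfadj (V o\<^sub>L T o\<^sub>L U)"
  shows "fun_calc (V o\<^sub>L T o\<^sub>L U) f = V o\<^sub>L fun_calc T f o\<^sub>L U"
proof -
  interpret S: spectral_interval "V o\<^sub>L T o\<^sub>L U" a b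
    by unfold_locales (use S spectrum op_spectrum_similar[OF UV] in auto)
  obtain p where p: "uniform_limit {a..b} (\<lambda>n. poly (p n)) f sequentially"
    using Weierstrass_real_poly[OF f] .
  have "(\<lambda>n. V o\<^sub>L poly_op (p n) T o\<^sub>L U) \<longlonglongrightarrow> (V o\<^sub>L fun_calc T f o\<^sub>L U)"
    by (intro bounded_bilinear.tendsto[OF bounded_bilinear_blinfun_compose] tendsto_const
        fun_calc_limit f p)
  then show ?thesis
    using LIMSEQ_unique[OF S.fun_calc_limit[OF f p]] by (simp add: poly_op_similar[OF UV])
qed

section \<open>Powers of positive definite operators\<close>

lemma posdef_iff:
  "T \<in> posdef \<longleftrightarrow> selfadj T \<and> (\<forall>x. 0 \<le> inner (blinfun_apply T x) x) \<and> invertible_op T"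
  by (simp add: posdef_def selfadj_def)

text \<open>With \<open>M \<ge> \<parallel>T\<parallel>\<close>, expanding \<open>0 \<le> \<langle>T y, y\<rangle>\<close> for \<open>y = M x - T x\<close> gives
  \<open>\<parallel>T x\<parallel>\<^sup>2 \<le> M \<langle>T x, x\<rangle>\<close>.\<close>

lemma posdef_coercive:
  assumes "T \<in> posdef"
  obtains c where "c > 0" "\<And>x. c * (norm x)\<^sup>2 \<le> inner (blinfun_apply T x) x"
proof -
  have T: "selfadj T" "\<And>x. 0 \<le> inner (blinfun_apply T x) x" "invertible_op T"
    using assms by (auto simp: posdef_iff)
  obtain K where K: "K > 0" "\<And>x. norm x \<le> K * norm (blinfun_apply T x)"
    using invertible_op_bounded_below[OF T(3)] by blast
  define M where "M = norm T + 1"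
  have M: "M > 0" "norm T \<le> M"
    by (auto simp: M_def add_nonneg_pos)
  have main: "(norm (blinfun_apply T x))\<^sup>2 \<le> M * inner (blinfun_apply T x) x" for x
  proof -
    let ?y = "blinfun_apply T x"
    have "inner (blinfun_apply T ?y) ?y \<le> norm (blinfun_apply T ?y) * norm ?y"
      by (rule norm_cauchy_schwarz)
    also have "\<dots> \<le> (M * norm ?y) * norm ?y"
      by (intro mult_right_mono order_trans[OF norm_blinfun] M(2)) simp_all
    finally have 1: "inner (blinfun_apply T ?y) ?y \<le> M * inner ?y ?y"
      by (simp add: power2_norm_eq_inner[symmetric] power2_eq_square)
    have 2: "inner (blinfun_apply T ?y) x = inner ?y ?y"
      using selfadjD[OF T(1), of ?y x] by simp
    have "0 \<le> inner (blinfun_apply T (M *\<^sub>R x - ?y)) (M *\<^sub>R x - ?y)"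
      by (rule T(2))
    also have "\<dots> = M * M * inner ?y x - 2 * M * inner ?y ?y + inner (blinfun_apply T ?y) ?y"
      by (simp add: blinfun.bilinear_simps inner_simps 2 algebra_simps)
    also have "\<dots> \<le> M * (M * inner ?y x - inner ?y ?y)"
      using 1 by (simp add: algebra_simps)
    finally show ?thesis
      using M(1) by (simp add: zero_le_mult_iff power2_norm_eq_inner)
  qed
  show thesis
  proof
    \<comment> \<open>The constant comes from |x|^2 \<le> K^2 |T x|^2 \<le> K^2 M <T x, x>.\<close>
    show "1 / (K\<^sup>2 * M) > 0"
      using K(1) M(1) by simp
    show "1 / (K\<^sup>2 * M) * (norm x)\<^sup>2 \<le> inner (blinfun_apply T x) x" for x
    proof -
      have "(norm x)\<^sup>2 \<le> K\<^sup>2 * (norm (blinfun_apply T x))\<^sup>2"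
        using K(2)[of x] by (metis norm_ge_zero power_mono power_mult_distrib)
      also have "\<dots> \<le> K\<^sup>2 * (M * inner (blinfun_apply T x) x)"
        by (intro mult_left_mono main) simp
      finally show ?thesis
        using K(1) M(1) by (simp add: field_simps)
    qed
  qed
qed

lemma invertible_op_minus:
  assumes "invertible_op T"
  shows "invertible_op (- T)"
  using invertible_op_scaleR[OF assms, of "-1"] by simp

text \<open>With coercivity constant c, the operator T - r is coercive for r < c, and r - T is
  coercive for r > norm T. The positive left end makes every real power continuous on the
  interval.\<close>

lemma posdef_spectral_interval:
  fixes T :: "'a::{real_inner, complete_space} \<Rightarrow>\<^sub>L 'a"
  assumes "T \<in> posdef"
  obtains a b where "a > 0" "spectral_interval T a b"
proof -
  have T: "selfadj T"
    using assms by (simp add: posdef_iff)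
  obtain c where c: "c > 0" "\<And>x. c * (norm x)\<^sup>2 \<le> inner (blinfun_apply T x) x"
    using posdef_coercive[OF assms] by blast
  have "c \<le> r" if "r \<in> op_spectrum T" for r
  proof (rule ccontr)
    assume "\<not> c \<le> r"
    then have "invertible_op (T - r *\<^sub>R id_blinfun)"
      using c(2) by (intro coercive_invertible[of "c - r"])
        (auto simp: blinfun.bilinear_simps inner_simps power2_norm_eq_inner algebra_simps)
    then show False
      using that by (simp add: op_spectrum_def)
  qed
  moreover have "r \<le> norm T" if "r \<in> op_spectrum T" for r
  proof (rule ccontr)
    assume "\<not> r \<le> norm T"
    moreover have "inner (blinfun_apply T x) x \<le> norm T * inner x x" for x
    proof -
      have "inner (blinfun_apply T x) x \<le> norm (blinfun_apply T x) * norm x"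
        by (rule norm_cauchy_schwarz)
      also have "\<dots> \<le> norm T * norm x * norm x"
        by (intro mult_right_mono norm_blinfun) simp
      finally show ?thesis
        by (simp add: power2_norm_eq_inner[symmetric] power2_eq_square)
    qed
    ultimately have "invertible_op (r *\<^sub>R id_blinfun - T)"
      by (intro coercive_invertible[of "r - norm T"])
        (auto simp: blinfun.bilinear_simps inner_simps power2_norm_eq_inner algebra_simps)
    then have "invertible_op (T - r *\<^sub>R id_blinfun)"
      using invertible_op_minus by fastforce
    then show False
      using that by (simp add: op_spectrum_def)
  qed
  ultimately have "spectral_interval T c (norm T)"
    using T by unfold_locales auto
  with c(1) show thesis
    by (rule that)
qed

lemma spectral_interval_mono:
  "spectral_interval T a b \<Longrightarrow> c \<le> a \<Longrightarrow> b \<le> d \<Longrightarrow> spectral_interval T c d"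
  unfolding spectral_interval_def by (auto dest!: subsetD)

lemma continuous_on_powr_pos:
  "a > 0 \<Longrightarrow> continuous_on {a..b} (\<lambda>x::real. x powr t)"
  by (intro continuous_intros) auto

lemma op_powr_add:
  fixes T :: "'a::{real_inner, complete_space} \<Rightarrow>\<^sub>L 'a"
  assumes "T \<in> posdef"
  shows "op_powr T s o\<^sub>L op_powr T t = op_powr T (s + t)"
proof -
  obtain a b where a: "a > 0" and "spectral_interval T a b"
    using posdef_spectral_interval[OF assms] .
  then interpret spectral_interval T a b
    by simp
  show ?thesis
    unfolding op_powr_def powr_add
    by (rule fun_calc_mult[symmetric]; rule continuous_on_powr_pos[OF a])
qed

lemma op_powr_zero:
  fixes T :: "'a::{real_inner, complete_space} \<Rightarrow>\<^sub>L 'a"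
  assumes "T \<in> posdef"
  shows "op_powr T 0 = id_blinfun"
proof -
  obtain a b where a: "a > 0" and "spectral_interval T a b"
    using posdef_spectral_interval[OF assms] .
  then interpret spectral_interval T a b
    by simp
  \<comment> \<open>At x = 0 the value of \<open>x powr 0\<close> is 0, so the functions agree only
    because the interval is positive.\<close>
  have "op_powr T 0 = fun_calc T (\<lambda>x. 1)"
    unfolding op_powr_def by (rule fun_calc_cong[OF continuous_on_powr_pos[OF a]]) (use a in auto)
  then show ?thesis
    by (simp add: fun_calc_const)
qed

lemma op_powr_one:
  fixes T :: "'a::{real_inner, complete_space} \<Rightarrow>\<^sub>L 'a"
  assumes "T \<in> posdef"
  shows "op_powr T 1 = T"
proof -
  obtain a b where a: "a > 0" and "spectral_interval T a b"
    using posdef_spectral_interval[OF assms] .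
  then interpret spectral_interval T a b
    by simp
  have "op_powr T 1 = fun_calc T (\<lambda>x. x)"
    unfolding op_powr_def by (rule fun_calc_cong[OF continuous_on_powr_pos[OF a]]) (use a in auto)
  then show ?thesis
    by (simp add: fun_calc_ident)
qed

lemma selfadj_op_powr:
  fixes T :: "'a::{real_inner, complete_space} \<Rightarrow>\<^sub>L 'a"
  assumes "T \<in> posdef"
  shows "selfadj (op_powr T t)"
proof -
  obtain a b where a: "a > 0" and "spectral_interval T a b"
    using posdef_spectral_interval[OF assms] .
  then show ?thesis
    unfolding op_powr_def by (intro spectral_interval.selfadj_fun_calc continuous_on_powr_pos)
qed

lemma op_powr_commute:
  fixes T :: "'a::{real_inner, complete_space} \<Rightarrow>\<^sub>L 'a"
  assumes "T \<in> posdef" "T o\<^sub>L S = S o\<^sub>L T"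
  shows "op_powr T t o\<^sub>L S = S o\<^sub>L op_powr T t"
proof -
  obtain a b where a: "a > 0" and "spectral_interval T a b"
    using posdef_spectral_interval[OF assms(1)] .
  then show ?thesis
    unfolding op_powr_def
    by (intro spectral_interval.fun_calc_commute continuous_on_powr_pos assms(2))
qed

text \<open>The second form cancels inside compositions nested to the right. With the premise
  \<open>s + t = 0\<close>, numeral exponents such as 1/2 and -1/2 match directly.\<close>

lemma op_powr_cancel:
  fixes T :: "'a::{real_inner, complete_space} \<Rightarrow>\<^sub>L 'a"
  assumes "T \<in> posdef" "s + t = 0"
  shows "op_powr T s o\<^sub>L op_powr T t = id_blinfun"
    and "op_powr T s o\<^sub>L (op_powr T t o\<^sub>L S) = S"
proof -
  show *: "op_powr T s o\<^sub>L op_powr T t = id_blinfun"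
    using assms by (simp add: op_powr_add op_powr_zero)
  then show "op_powr T s o\<^sub>L (op_powr T t o\<^sub>L S) = S"
    by (simp flip: blinfun_compose_assoc)
qed

text \<open>T^t is the square of the self-adjoint T^(t/2), so its quadratic form at x is |T^(t/2)
  x|^2; its inverse is T^(-t).\<close>

lemma posdef_op_powr:
  fixes T :: "'a::{real_inner, complete_space} \<Rightarrow>\<^sub>L 'a"
  assumes T: "T \<in> posdef"
  shows "op_powr T t \<in> posdef"
  unfolding posdef_iff
proof (intro conjI allI)
  show "selfadj (op_powr T t)"
    by (rule selfadj_op_powr[OF T])
  show "invertible_op (op_powr T t)"
    unfolding invertible_op_def
    by (intro exI[of _ "op_powr T (- t)"]) (simp add: op_powr_cancel[OF T])
  fix x
  have "op_powr T t = op_powr T (t / 2) o\<^sub>L op_powr T (t / 2)"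
    by (simp add: op_powr_add[OF T])
  then have "inner (blinfun_apply (op_powr T t) x) x =
      inner (blinfun_apply (op_powr T (t / 2)) x) (blinfun_apply (op_powr T (t / 2)) x)"
    by (metis blinfun_apply_blinfun_compose selfadjD selfadj_op_powr[OF T])
  then show "0 \<le> inner (blinfun_apply (op_powr T t) x) x"
    by simp
qed

lemma op_powr_powr:
  fixes T :: "'a::{real_inner, complete_space} \<Rightarrow>\<^sub>L 'a"
  assumes T: "T \<in> posdef"
  shows "op_powr (op_powr T s) t = op_powr T (s * t)"
proof -
  obtain a b where a: "a > 0" and "spectral_interval T a b"
    using posdef_spectral_interval[OF T] .
  then interpret spectral_interval T a b
    by simp
  obtain c d where c: "c > 0" and S: "spectral_interval (op_powr T s) c d"
    using posdef_spectral_interval[OF posdef_op_powr[OF T]] .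
  \<comment> \<open>A bound for |s ln x| on \<open>{a..b}\<close>, valid for either sign of
    \<open>s\<close>.\<close>
  define R where "R = \<bar>s\<bar> * (\<bar>ln a\<bar> + \<bar>ln b\<bar>)"
  \<comment> \<open>The target interval covers both the values of x^s and the spectrum of T^s, and
    its left end stays positive.\<close>
  have image: "(\<lambda>x. x powr s) ` {a..b} \<subseteq> {min c (exp (- R))..max d (exp R)}"
  proof (rule image_subsetI)
    fix x assume x: "x \<in> {a..b}"
    then have "ln a \<le> ln x" "ln x \<le> ln b"
      using a by auto
    then have "\<bar>ln x\<bar> \<le> \<bar>ln a\<bar> + \<bar>ln b\<bar>"
      by linarith
    then have "\<bar>s * ln x\<bar> \<le> R"
      unfolding R_def abs_mult by (rule mult_left_mono) simp
    then show "x powr s \<in> {min c (exp (- R))..max d (exp R)}"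
      using x a by (auto simp: powr_def abs_le_iff min_le_iff_disj le_max_iff_disj)
  qed
  have pos: "0 < min c (exp (- R))"
    using c by simp
  have "op_powr (op_powr T s) t = fun_calc T (\<lambda>x. (x powr s) powr t)"
    unfolding op_powr_def
    by (rule fun_calc_compose[OF continuous_on_powr_pos[OF a] image continuous_on_powr_pos[OF pos]])
      (rule spectral_interval_mono[OF S[unfolded op_powr_def]]; simp)
  then show ?thesis
    by (simp add: powr_powr op_powr_def)
qed

lemma op_powr_similar:
  fixes T U V :: "'a::{real_inner, complete_space} \<Rightarrow>\<^sub>L 'a"
  assumes T: "T \<in> posdef" and "V o\<^sub>L T o\<^sub>L U \<in> posdef"
    and UV: "U o\<^sub>L V = id_blinfun" "V o\<^sub>L U = id_blinfun"
  shows "op_powr (V o\<^sub>L T o\<^sub>L U) t = V o\<^sub>L op_powr T t o\<^sub>L U"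
proof -
  obtain a b where a: "a > 0" and "spectral_interval T a b"
    using posdef_spectral_interval[OF T] .
  then show ?thesis
    unfolding op_powr_def using assms
    by (intro spectral_interval.fun_calc_similar[OF _ continuous_on_powr_pos[OF a]])
      (auto simp: posdef_iff)
qed

lemma posdef_congruence:
  assumes T: "T \<in> posdef" and S: "S \<in> posdef"
  shows "S o\<^sub>L T o\<^sub>L S \<in> posdef"
proof -
  have adj: "inner (blinfun_apply S x) y = inner x (blinfun_apply S y)" for x y
    using S by (auto simp: posdef_iff selfadjD)
  show ?thesis
    using assms unfolding posdef_iff
    by (auto simp: selfadj_def adj intro!: invertible_op_compose) (simp flip: adj)
qed

section \<open>Weighted geometric means\<close>

text \<open>Here B = A^(1/2) C A^(1/2), and the inner power of the right-hand side is V C^(t-1) U.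
  Multiplying by B^(1/2) on both sides turns \<open>?V\<close> into B A^(-1/2) = A^(1/2) C and
  \<open>?U\<close> into A^(1/2), which raises the exponent of C to t.\<close>

lemma geom_mean_swap:
  fixes A B :: "'a::{real_inner, complete_space} \<Rightarrow>\<^sub>L 'a"
  assumes A: "A \<in> posdef" and B: "B \<in> posdef"
  shows "geom_mean t A B = geom_mean (1 - t) B A"
proof -
  define C where "C = op_powr A (-1/2) o\<^sub>L B o\<^sub>L op_powr A (-1/2)"
  have C: "C \<in> posdef"
    unfolding C_def by (intro posdef_congruence posdef_op_powr A B)
  note cancel = op_powr_cancel[OF A] op_powr_cancel[OF B] op_powr_cancel[OF C]
  have B_eq: "B = op_powr A (1/2) o\<^sub>L (C o\<^sub>L op_powr A (1/2))"
    by (simp add: C_def blinfun_compose_assoc cancel)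
  let ?U = "op_powr A (1/2) o\<^sub>L op_powr B (-1/2)" and ?V = "op_powr B (1/2) o\<^sub>L op_powr A (-1/2)"
  have UV: "?U o\<^sub>L ?V = id_blinfun" "?V o\<^sub>L ?U = id_blinfun"
    by (simp_all add: blinfun_compose_assoc cancel)
  \<comment> \<open>The trailing factor \<open>S\<close> in this and the next two rules lets them
    rewrite inside compositions nested to the right.\<close>
  have BA: "B o\<^sub>L (op_powr A (-1/2) o\<^sub>L S) = op_powr A (1/2) o\<^sub>L (C o\<^sub>L S)" for S
    by (subst B_eq) (simp add: blinfun_compose_assoc cancel)
  have C1: "C o\<^sub>L (op_powr C s o\<^sub>L S) = op_powr C (1 + s) o\<^sub>L S" for s S
    using op_powr_add[OF C, of 1 s] by (simp add: op_powr_one[OF C] flip: blinfun_compose_assoc)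
  have B1: "op_powr B (-1/2) o\<^sub>L (B o\<^sub>L S) = op_powr B (1/2) o\<^sub>L S" for S
    using op_powr_add[OF B, of "-1/2" 1]
    by (simp add: op_powr_one[OF B] flip: blinfun_compose_assoc)
  \<comment> \<open>Splitting B^(1/2) into B^(-1/2) B lets \<open>BA\<close> produce a factor
    \<open>C\<close> that cancels C^(-1).\<close>
  have "?V o\<^sub>L op_powr C (-1) o\<^sub>L ?U =
      op_powr B (-1/2) o\<^sub>L (B o\<^sub>L (op_powr A (-1/2) o\<^sub>L (op_powr C (-1) o\<^sub>L ?U)))"
    by (simp only: B1 blinfun_compose_assoc)
  also have "\<dots> = op_powr B (-1/2) o\<^sub>L (op_powr A (1/2) o\<^sub>L ?U)"
    by (simp only: BA C1) (simp add: op_powr_zero[OF C])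
  also have "\<dots> = op_powr B (-1/2) o\<^sub>L A o\<^sub>L op_powr B (-1/2)"
    using op_powr_add[OF A, of "1/2" "1/2"]
    by (simp add: op_powr_one[OF A] flip: blinfun_compose_assoc)
  finally have D: "?V o\<^sub>L op_powr C (-1) o\<^sub>L ?U = op_powr B (-1/2) o\<^sub>L A o\<^sub>L op_powr B (-1/2)" .
  \<comment> \<open>Positivity of the similar operator is read off from \<open>D\<close>, which
    shows it to be a congruence of \<open>A\<close>.\<close>
  have "op_powr (?V o\<^sub>L op_powr C (-1) o\<^sub>L ?U) (1 - t) = ?V o\<^sub>L op_powr (op_powr C (-1)) (1 - t) o\<^sub>L ?U"
    by (rule op_powr_similar[OF _ _ UV])
      (auto simp only: D intro!: posdef_congruence posdef_op_powr A B C)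
  then have "op_powr (op_powr B (-1/2) o\<^sub>L A o\<^sub>L op_powr B (-1/2)) (1 - t) = ?V o\<^sub>L op_powr C (t - 1) o\<^sub>L ?U"
    unfolding D by (simp add: op_powr_powr[OF C])
  then have "geom_mean (1 - t) B A =
      op_powr B (1/2) o\<^sub>L (op_powr B (1/2) o\<^sub>L (op_powr A (-1/2) o\<^sub>L (op_powr C (t - 1) o\<^sub>L op_powr A (1/2))))"
    by (simp add: geom_mean_def blinfun_compose_assoc cancel)
  also have "\<dots> = B o\<^sub>L (op_powr A (-1/2) o\<^sub>L (op_powr C (t - 1) o\<^sub>L op_powr A (1/2)))"
    using op_powr_add[OF B, of "1/2" "1/2"]
    by (simp add: op_powr_one[OF B] flip: blinfun_compose_assoc)
  also have "\<dots> = op_powr A (1/2) o\<^sub>L op_powr C t o\<^sub>L op_powr A (1/2)"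
    by (simp only: BA C1) (simp add: blinfun_compose_assoc)
  also have "\<dots> = geom_mean t A B"
    by (simp only: geom_mean_def C_def)
  finally show ?thesis ..
qed

text \<open>Removing the outer factors from A #_s X leaves C^s, whose t-th power is C. The symmetry
  of the premise in \<open>s\<close> and \<open>t\<close> yields both directions of the
  bijection.\<close>

lemma geom_mean_inverse:
  fixes A X :: "'a::{real_inner, complete_space} \<Rightarrow>\<^sub>L 'a"
  assumes A: "A \<in> posdef" and X: "X \<in> posdef" and st: "s * t = 1"
  shows "geom_mean t A (geom_mean s A X) = X"
proof -
  define C where "C = op_powr A (-1/2) o\<^sub>L X o\<^sub>L op_powr A (-1/2)"
  have C: "C \<in> posdef"
    unfolding C_def by (intro posdef_congruence posdef_op_powr A X)
  note cancel = op_powr_cancel[OF A]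
  have "geom_mean s A X = op_powr A (1/2) o\<^sub>L op_powr C s o\<^sub>L op_powr A (1/2)"
    by (simp only: geom_mean_def C_def)
  then have "op_powr A (-1/2) o\<^sub>L geom_mean s A X o\<^sub>L op_powr A (-1/2) = op_powr C s"
    by (simp add: blinfun_compose_assoc cancel)
  then have "geom_mean t A (geom_mean s A X) =
      op_powr A (1/2) o\<^sub>L op_powr (op_powr C s) t o\<^sub>L op_powr A (1/2)"
    by (simp add: geom_mean_def[of t])
  then show ?thesis
    by (simp add: op_powr_powr[OF C] st op_powr_one[OF C])
      (simp add: C_def blinfun_compose_assoc cancel)
qed

text \<open>The parameter \<open>J\<close> unites the two scalar fields: the empty set imposes
  nothing, and the multiplications by complex scalars single out the complex-linear
  operators.\<close>

definition commutant :: "('a::real_normed_vector \<Rightarrow>\<^sub>L 'a) set \<Rightarrow> ('a \<Rightarrow>\<^sub>L 'a) set" where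
  "commutant J = {T. \<forall>S\<in>J. T o\<^sub>L S = S o\<^sub>L T}"

lemma commutant_compose: "S \<in> commutant J \<Longrightarrow> T \<in> commutant J \<Longrightarrow> S o\<^sub>L T \<in> commutant J"
  unfolding commutant_def by (simp add: blinfun_compose_assoc) (simp flip: blinfun_compose_assoc)

lemma commutant_op_powr:
  fixes T :: "'a::{real_inner, complete_space} \<Rightarrow>\<^sub>L 'a"
  shows "T \<in> posdef \<Longrightarrow> T \<in> commutant J \<Longrightarrow> op_powr T t \<in> commutant J"
  unfolding commutant_def by (simp add: op_powr_commute)

lemma geom_mean_closed:
  fixes A X :: "'a::{real_inner, complete_space} \<Rightarrow>\<^sub>L 'a"
  assumes "A \<in> posdef \<inter> commutant J" "X \<in> posdef \<inter> commutant J"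
  shows "geom_mean t A X \<in> posdef \<inter> commutant J"
  using assms unfolding geom_mean_def
  by (auto intro!: posdef_congruence posdef_op_powr commutant_compose commutant_op_powr)

lemma bij_betw_geom_mean_right:
  fixes A :: "'a::{real_inner, complete_space} \<Rightarrow>\<^sub>L 'a"
  assumes A: "A \<in> posdef \<inter> commutant J" and t: "t \<noteq> 0"
  shows "bij_betw (\<lambda>X. geom_mean t A X) (posdef \<inter> commutant J) (posdef \<inter> commutant J)"
proof (rule bij_betw_byWitness[where f' = "\<lambda>Y. geom_mean (1 / t) A Y"])
  \<comment> \<open>Kept general in \<open>s\<close> to serve both \<open>t\<close> and
    \<open>1 / t\<close>; the latter may exceed 1.\<close>
  show "(\<lambda>X. geom_mean s A X) ` (posdef \<inter> commutant J) \<subseteq> posdef \<inter> commutant J" for s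
    by (intro image_subsetI geom_mean_closed A)
  then show "(\<lambda>X. geom_mean (1 / t) A X) ` (posdef \<inter> commutant J) \<subseteq> posdef \<inter> commutant J" .
qed (use A t in \<open>auto simp: geom_mean_inverse\<close>)

lemma bij_betw_geom_mean_left:
  fixes B :: "'a::{real_inner, complete_space} \<Rightarrow>\<^sub>L 'a"
  assumes B: "B \<in> posdef \<inter> commutant J" and t: "t \<noteq> 1"
  shows "bij_betw (\<lambda>X. geom_mean t X B) (posdef \<inter> commutant J) (posdef \<inter> commutant J)"
proof -
  have "bij_betw (\<lambda>X. geom_mean (1 - t) B X) (posdef \<inter> commutant J) (posdef \<inter> commutant J)"
    by (rule bij_betw_geom_mean_right[OF B]) (use t in simp)
  then show ?thesis
    using B geom_mean_swap by (subst bij_betw_cong) auto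
qed

section \<open>Complex Hilbert spaces\<close>

lemma bounded_linear_scaleC: "bounded_linear (\<lambda>x::'a::complex_hilbert. c *\<^sub>C x)"
proof (rule bounded_linear_intro)
  fix r and x y :: 'a
  show "c *\<^sub>C (x + y) = c *\<^sub>C x + c *\<^sub>C y"
    by (rule scaleC_add_right)
  show "c *\<^sub>C (r *\<^sub>R x) = r *\<^sub>R (c *\<^sub>C x)"
    by (simp add: scaleR_scaleC scaleC_scaleC mult.commute)
  have "cinner (c *\<^sub>C x) (c *\<^sub>C x) = c * cnj c * cinner x x"
    by (metis cinner_commute cinner_scaleC_left complex_cnj_mult mult.assoc)
  also have "c * cnj c = of_real ((cmod c)\<^sup>2)"
    by (rule complex_norm_square[symmetric])
  finally have "inner (c *\<^sub>C x) (c *\<^sub>C x) = (cmod c)\<^sup>2 * inner x x"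
    by (simp add: inner_eq_Re_cinner)
  then have "(norm (c *\<^sub>C x))\<^sup>2 = (norm x * cmod c)\<^sup>2"
    by (simp add: power2_norm_eq_inner power_mult_distrib mult.commute)
  then show "norm (c *\<^sub>C x) \<le> norm x * cmod c"
    by (simp add: power2_eq_iff_nonneg)
qed

text \<open>Complex-linearity means commuting with all scalar multiplications, and
  \<open>invertible_op\<close> is the same notion on both sides. What remains is to recover the
  complex symmetry from its real part.\<close>

lemma cposdef_eq_posdef_commutant:
  "cposdef = posdef \<inter> commutant (range (\<lambda>c. Blinfun (\<lambda>x::'a::complex_hilbert. c *\<^sub>C x)))"
    (is "_ = _ \<inter> commutant ?J")
proof (intro equalityI subsetI)
  note scaleC_apply = bounded_linear_Blinfun_apply[OF bounded_linear_scaleC]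
  fix T :: "'a \<Rightarrow>\<^sub>L 'a"
  show "T \<in> posdef \<inter> commutant ?J" if "T \<in> cposdef"
    using that
    by (auto simp: cposdef_def posdef_def commutant_def inner_eq_Re_cinner scaleC_apply
        complex_nonneg_Reals_iff intro!: blinfun_eqI)
  assume T: "T \<in> posdef \<inter> commutant ?J"
  have lin: "blinfun_apply T (c *\<^sub>C x) = c *\<^sub>C blinfun_apply T x" for c x
  proof -
    have "T o\<^sub>L Blinfun (\<lambda>x. c *\<^sub>C x) = Blinfun (\<lambda>x. c *\<^sub>C x) o\<^sub>L T"
      using T by (auto simp: commutant_def)
    then show ?thesis
      by (metis blinfun_apply_blinfun_compose scaleC_apply)
  qed
  have Re: "Re (cinner (blinfun_apply T x) y) = Re (cinner x (blinfun_apply T y))" for x y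
    using T by (auto simp: posdef_def inner_eq_Re_cinner)
  \<comment> \<open>The real parts at \<open>\<i> *\<^sub>C x\<close> are the negated imaginary
    parts at \<open>x\<close>.\<close>
  have sym: "cinner (blinfun_apply T x) y = cinner x (blinfun_apply T y)" for x y
    using Re[of x y] Re[of "\<i> *\<^sub>C x" y]
    by (simp add: lin cinner_scaleC_left complex_eq_iff)
  have "Im (cinner (blinfun_apply T x) x) = 0" for x
    using arg_cong[OF cinner_commute[of "blinfun_apply T x" x], of Im] sym[of x x] by simp
  then show "T \<in> cposdef"
    using T lin sym by (auto simp: cposdef_def posdef_def inner_eq_Re_cinner complex_nonneg_Reals_iff)
qed

theorem theorem2p1:
  fixes A B :: "'h::{real_inner, complete_space} \<Rightarrow>\<^sub>L 'h"
    and C D :: "'k::complex_hilbert \<Rightarrow>\<^sub>L 'k"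
  shows
    "(A \<in> posdef \<longrightarrow> B \<in> posdef \<longrightarrow>
        (\<forall>t \<in> {0<..1}. bij_betw (\<lambda>X. geom_mean t A X) posdef posdef) \<and>
        (\<forall>t \<in> {0..<1}. bij_betw (\<lambda>X. geom_mean t X B) posdef posdef)) \<and>
     (C \<in> cposdef \<longrightarrow> D \<in> cposdef \<longrightarrow>
        (\<forall>t \<in> {0<..1}. bij_betw (\<lambda>X. geom_mean t C X) cposdef cposdef) \<and>
        (\<forall>t \<in> {0..<1}. bij_betw (\<lambda>X. geom_mean t X D) cposdef cposdef))"
proof -
  \<comment> \<open>The real case is the instance \<open>J = {}\<close>.\<close>
  have "posdef = posdef \<inter> commutant ({} :: ('h \<Rightarrow>\<^sub>L 'h) set)"
    by (simp add: commutant_def)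
  then show ?thesis
    using bij_betw_geom_mean_right[of A "{}"] bij_betw_geom_mean_left[of B "{}"]
      bij_betw_geom_mean_right[of C] bij_betw_geom_mean_left[of D]
    by (auto simp: cposdef_eq_posdef_commutant)
qed

end
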